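(* Let $d,d'\ge 2$ be integers. A supply of $d$-boxes can simulate a $d'$-box to arbitrarily high precision, with error tending to zero exponentially fast in the number of $d$-boxes: there exist constants $C>0$ and $0<c<1$ such that for every $n\ge 1$ there is a protocol with which Alice and Bob, using $n$ $d$-boxes, exactly simulate some box with inputs $X,Y\in\{0,1\}$, outputs $a,b\in\{0,\ldots,d'-1\}$ and probabilities $q^{(n)}_{ab|XY}$ satisfying $$\bigl|q^{(n)}_{ab|XY}-p_{ab|XY}\bigr|\le C\,c^{\,n}\qquad\text{for all } a,b,X,Y,$$ where $p_{ab|XY}$ are the probabilities of a $d'$-box.
   Context: For an integer $d\ge 2$, a $d$-box is the bipartite non-signalling box with inputs $X,Y\in\{0,1\}$ and outputs $a,b\in\{0,\ldots,d-1\}$ with joint output probabilities $p_{ab|XY}=1/d$ if $(b-a)\bmod d=X\cdot Y$ and $p_{ab|XY}=0$ otherwise. Here $X$ (input) and $a$ (output) belong to Alice, $Y$ and $b$ to Bob. Simulation using boxes (no communication): Alice and Bob share resource boxes $1,\ldots,n$ with probabilities $p^{(i)}$, each usable once. A deterministic local strategy of Alice, for a given global input $X$, is an adaptive rule by which she uses each box exactly once at her side: at each step she chooses the next unused box and the input to it as functions of $X$ and of the outputs she has already received; her final output $a$ is a function of $X$ and all outputs received. Thus a record $\alpha=(\alpha_1,\ldots,\alpha_n)$ of her box outputs determines the record $x(\alpha)=(x_1,\ldots,x_n)$ of her box inputs. Bob has a strategy of the same kind, with global input $Y$, records $\beta$ and $y(\beta)$, and final output $b$; the two parties may use the boxes in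 different orders. The probability of records $(\alpha,\beta)$ is $\prod_{i=1}^n p^{(i)}_{\alpha_i\beta_i|x_i(\alpha)y_i(\beta)}$. The parties may also choose their deterministic strategies according to local and shared random data that is independent of the global inputs. The resource boxes exactly simulate a target box if some such protocol yields, for every pair of global inputs, final outputs distributed exactly as the target box prescribes. *)

theory Defs
  imports "HOL-Probability.Probability"
begin

(* p a b X Y is the probability of Alice's output a and Bob's output b given her input X
   and his input Y. Only inputs in {0,1} and outputs below the number of outputs matter. *)
type_synonym box = "nat \<Rightarrow> nat \<Rightarrow> nat \<Rightarrow> nat \<Rightarrow> real"

definition nonsignalling_box :: "nat \<Rightarrow> box \<Rightarrow> bool" where
  "nonsignalling_box d p \<longleftrightarrow>
     (\<forall>X\<in>{0,1}. \<forall>Y\<in>{0,1}.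
        (\<forall>a<d. \<forall>b<d. 0 \<le> p a b X Y) \<and> (\<Sum>a<d. \<Sum>b<d. p a b X Y) = 1) \<and>
     (\<forall>a<d. \<forall>X\<in>{0,1}. (\<Sum>b<d. p a b X 0) = (\<Sum>b<d. p a b X 1)) \<and>
     (\<forall>b<d. \<forall>Y\<in>{0,1}. (\<Sum>a<d. p a b 0 Y) = (\<Sum>a<d. p a b 1 Y))"

definition d_box :: "nat \<Rightarrow> box" where
  "d_box d a b X Y = (if (int b - int a) mod int d = int (X * Y) then 1 / real d else 0)"

(* A party's adaptive rule for one fixed global input, as a decision tree: Use i x f inputs x
   into box i and continues with f r on receiving r; Final a ends with final output a. *)
datatype strategy = Final nat | Use nat nat "nat \<Rightarrow> strategy"

(* Box i has outputs below k i, the final output is below d', and on each branch that can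
   occur every box in I is used exactly once. *)
primrec valid_strategy :: "(nat \<Rightarrow> nat) \<Rightarrow> nat \<Rightarrow> strategy \<Rightarrow> nat set \<Rightarrow> bool" where
  "valid_strategy k d' (Final a) I \<longleftrightarrow> I = {} \<and> a < d'"
| "valid_strategy k d' (Use i x f) I \<longleftrightarrow>
     i \<in> I \<and> x \<in> {0,1} \<and> (\<forall>r<k i. valid_strategy k d' (f r) (I - {i}))"

(* box_input S \<alpha> is the input record determined by the output record \<alpha>; the value 0 in
   the Final case concerns only boxes that S never uses. *)
primrec box_input :: "strategy \<Rightarrow> (nat \<Rightarrow> nat) \<Rightarrow> nat \<Rightarrow> nat" where
  "box_input (Final a) \<alpha> j = 0"
| "box_input (Use i x f) \<alpha> j = (if j = i then x else box_input (f (\<alpha> i)) \<alpha> j)"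

primrec final_output :: "strategy \<Rightarrow> (nat \<Rightarrow> nat) \<Rightarrow> nat" where
  "final_output (Final a) \<alpha> = a"
| "final_output (Use i x f) \<alpha> = final_output (f (\<alpha> i)) \<alpha>"

definition records :: "nat \<Rightarrow> (nat \<Rightarrow> nat) \<Rightarrow> (nat \<Rightarrow> nat) set" where
  "records n k = (\<Pi>\<^sub>E i\<in>{1..n}. {..<k i})"

definition record_prob ::
  "nat \<Rightarrow> (nat \<Rightarrow> box) \<Rightarrow> strategy \<Rightarrow> strategy \<Rightarrow> (nat \<Rightarrow> nat) \<Rightarrow> (nat \<Rightarrow> nat) \<Rightarrow> real" where
  "record_prob n P S T \<alpha> \<beta> =
     (\<Prod>i\<in>{1..n}. P i (\<alpha> i) (\<beta> i) (box_input S \<alpha> i) (box_input T \<beta> i))"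

definition output_prob ::
  "nat \<Rightarrow> (nat \<Rightarrow> nat) \<Rightarrow> (nat \<Rightarrow> box) \<Rightarrow> strategy \<Rightarrow> strategy \<Rightarrow> nat \<Rightarrow> nat \<Rightarrow> real" where
  "output_prob n k P S T a b =
     (\<Sum>\<alpha>\<in>{\<alpha> \<in> records n k. final_output S \<alpha> = a}.
      \<Sum>\<beta>\<in>{\<beta> \<in> records n k. final_output T \<beta> = b}. record_prob n P S T \<alpha> \<beta>)"

(* Boxes 1..n, with k i outputs and probabilities P i, exactly simulate the box q with d'
   outputs. Here \<mu> is the shared randomness, \<nu>A and \<nu>B the local randomness; all are
   independent of the global inputs X and Y. Natural-number-valued randomness is no
   restriction, because each party has only finitely many valid strategies up to behaviour
   on the outputs that can occur. *)
definition simulates ::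
  "nat \<Rightarrow> (nat \<Rightarrow> nat) \<Rightarrow> (nat \<Rightarrow> box) \<Rightarrow> nat \<Rightarrow> box \<Rightarrow> bool" where
  "simulates n k P d' q \<longleftrightarrow>
     (\<exists>(\<mu> :: nat pmf) (\<nu>A :: nat pmf) (\<nu>B :: nat pmf)
        (A :: nat \<Rightarrow> nat \<Rightarrow> nat \<Rightarrow> strategy) (B :: nat \<Rightarrow> nat \<Rightarrow> nat \<Rightarrow> strategy).
        (\<forall>s u. \<forall>X\<in>{0,1}. valid_strategy k d' (A s u X) {1..n}) \<and>
        (\<forall>s v. \<forall>Y\<in>{0,1}. valid_strategy k d' (B s v Y) {1..n}) \<and>
        (\<forall>X\<in>{0,1}. \<forall>Y\<in>{0,1}. \<forall>a<d'. \<forall>b<d'.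
           q a b X Y =
             measure_pmf.expectation (pair_pmf \<mu> (pair_pmf \<nu>A \<nu>B))
               (\<lambda>(s, u, v). output_prob n k P (A s u X) (B s v Y) a b)))"

end

(* n chained d-boxes give an exact d^n-box by addition with carry: the n box outputs are the
   base-d digits (least significant first) of two numbers u and v. Alice can see from her own
   digit whether adding X * Y = 1 to it would produce a carry, and the carry has again the form
   (a bit of Alice) * Y, so it can be fed into the next box. Hence u is uniform below D = d^n and
   v = (u + X * Y) mod D. Reducing u and v modulo d' then gives the d'-box up to the wrap-around
   event u = D - 1 and the non-uniformity of u mod d', each of which costs at most 1 / D. *)
theory Submission imports Defs begin

subsection \<open>A box with d outputs as modular addition\<close>

text \<open>The bound on \<open>X * Y\<close> makes it its own residue, so the defining condition
  becomes a congruence modulo \<open>d\<close>, which determines \<open>b\<close> because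
  \<open>b < d\<close>.\<close>

lemma d_box_eq:
  assumes "b < d" "X * Y < d"
  shows "d_box d a b X Y = (if b = (a + X * Y) mod d then 1 / real d else 0)"
proof -
  have "(int b - int a) mod int d = int (X * Y) \<longleftrightarrow>
      (int b - int a) mod int d = int (X * Y) mod int d"
    using assms by (simp only: mod_less flip: zmod_int)
  also have "\<dots> \<longleftrightarrow> int b mod int d = (int a + int (X * Y)) mod int d"
    by (simp only: mod_eq_dvd_iff diff_diff_add)
  also have "\<dots> \<longleftrightarrow> b = (a + X * Y) mod d"
    using assms by (simp only: mod_less of_nat_eq_iff flip: zmod_int of_nat_add)
  finally show ?thesis
    by (simp add: d_box_def)
qed

subsection \<open>The carry protocol\<close>

(* The boxes are used in the order m, m - 1, ..., 1; x is the current input bit, g updates it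
   from a received digit, and h maps the number with the received digits to the final output. *)
primrec digit_strategy ::
  "nat \<Rightarrow> (nat \<Rightarrow> nat \<Rightarrow> nat) \<Rightarrow> nat \<Rightarrow> nat \<Rightarrow> (nat \<Rightarrow> nat) \<Rightarrow> strategy" where
  "digit_strategy d g 0 x h = Final (h 0)"
| "digit_strategy d g (Suc m) x h =
     Use (Suc m) x (\<lambda>r. digit_strategy d g m (g r x) (\<lambda>v. h (r + d * v)))"

definition carry_input :: "nat \<Rightarrow> nat \<Rightarrow> nat \<Rightarrow> nat" where
  "carry_input d r x = (if r = d - 1 then x else 0)"

abbreviation alice :: "nat \<Rightarrow> nat \<Rightarrow> nat \<Rightarrow> (nat \<Rightarrow> nat) \<Rightarrow> strategy" where
  "alice d \<equiv> digit_strategy d (carry_input d)"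

text \<open>Every carry keeps the factor \<open>y\<close>, so Bob feeds the same bit into all
  boxes.\<close>

abbreviation bob :: "nat \<Rightarrow> nat \<Rightarrow> nat \<Rightarrow> (nat \<Rightarrow> nat) \<Rightarrow> strategy" where
  "bob d \<equiv> digit_strategy d (\<lambda>r y. y)"

text \<open>The box used first has the highest index and holds the lowest digit, so induction on the
  number of boxes follows the order of use.\<close>

primrec digit_value :: "nat \<Rightarrow> nat \<Rightarrow> (nat \<Rightarrow> nat) \<Rightarrow> nat" where
  "digit_value d 0 \<alpha> = 0"
| "digit_value d (Suc m) \<alpha> = \<alpha> (Suc m) + d * digit_value d m \<alpha>"

lemma valid_digit_strategy:
  assumes "\<And>v. h v < d'" and "x \<in> {0,1}" and "\<And>r x. x \<in> {0,1} \<Longrightarrow> g r x \<in> {0,1}"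
  shows "valid_strategy k d' (digit_strategy d g m x h) {1..m}"
  using assms(1,2)
proof (induction m arbitrary: x h)
  case (Suc m)
  have "{1..Suc m} - {Suc m} = {1..m}"
    by auto
  then show ?case
    using Suc.IH[OF Suc.prems(1) assms(3)[OF Suc.prems(2)]] Suc.prems(2) by simp
qed simp

lemma final_output_digit_strategy:
  "final_output (digit_strategy d g m x h) \<alpha> = h (digit_value d m \<alpha>)"
  by (induction m arbitrary: x h) simp_all

lemma digit_value_less:
  assumes "\<forall>i\<in>{1..m}. \<alpha> i < d"
  shows "digit_value d m \<alpha> < d ^ m"
  using assms
proof (induction m)
  case (Suc m)
  then have "\<alpha> (Suc m) < d" "Suc (digit_value d m \<alpha>) \<le> d ^ m"
    by (auto simp: Suc_le_eq)
  then have "\<alpha> (Suc m) + d * digit_value d m \<alpha> < d * Suc (digit_value d m \<alpha>)"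
    by simp
  also have "\<dots> \<le> d * d ^ m"
    using \<open>Suc (digit_value d m \<alpha>) \<le> d ^ m\<close> by (rule mult_le_mono2)
  finally show ?case
    by simp
qed simp

lemma digits_unique:
  fixes d :: nat
  assumes "r < d" "s < d"
  shows "r + d * v = s + d * w \<longleftrightarrow> r = s \<and> v = w"
proof
  assume eq: "r + d * v = s + d * w"
  have "(r + d * v) mod d = r" "(s + d * w) mod d = s"
      "(r + d * v) div d = v" "(s + d * w) div d = w"
    using assms by auto
  with eq show "r = s \<and> v = w"
    by metis
qed simp

lemma digit_value_inject:
  assumes "\<forall>i\<in>{1..m}. \<alpha> i < d" "\<forall>i\<in>{1..m}. \<beta> i < d"
    and "digit_value d m \<alpha> = digit_value d m \<beta>"
  shows "\<forall>i\<in>{1..m}. \<alpha> i = \<beta> i"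
  using assms
proof (induction m)
  case (Suc m)
  have "\<alpha> (Suc m) < d" "\<beta> (Suc m) < d"
    using Suc.prems(1,2) by simp_all
  then have eq: "\<alpha> (Suc m) = \<beta> (Suc m) \<and> digit_value d m \<alpha> = digit_value d m \<beta>"
    using Suc.prems(3) digits_unique by simp
  moreover have "\<forall>i\<in>{1..m}. \<alpha> i = \<beta> i"
    using eq Suc.prems(1,2) by (intro Suc.IH) simp_all
  ultimately show ?case
    by (simp add: atLeastAtMostSuc_conv)
qed simp

text \<open>Equal numbers have equal digits, and both sets have \<open>d ^ n\<close> elements, so
  injectivity is enough. Sums over records thereby become sums over numbers.\<close>

lemma bij_betw_digit_value:
  "bij_betw (digit_value d n) (records n (\<lambda>i. d)) {..<d ^ n}"
proof -
  let ?R = "records n (\<lambda>i. d)"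
  have lt: "\<forall>i\<in>{1..n}. \<alpha> i < d" if "\<alpha> \<in> ?R" for \<alpha>
    using that by (auto simp: records_def PiE_iff)
  have inj: "inj_on (digit_value d n) ?R"
  proof (rule inj_onI)
    fix \<alpha> \<beta> assume R: "\<alpha> \<in> ?R" "\<beta> \<in> ?R" and "digit_value d n \<alpha> = digit_value d n \<beta>"
    then have "\<forall>i\<in>{1..n}. \<alpha> i = \<beta> i"
      using digit_value_inject lt by blast
    with R show "\<alpha> = \<beta>"
      unfolding records_def by (meson PiE_ext)
  qed
  have "card (digit_value d n ` ?R) = card {..<d ^ n}"
    unfolding card_image[OF inj] by (simp add: records_def card_PiE)
  moreover have "digit_value d n ` ?R \<subseteq> {..<d ^ n}"
    using digit_value_less lt by blast
  ultimately have "digit_value d n ` ?R = {..<d ^ n}"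
    by (intro card_subset_eq) auto
  with inj show ?thesis
    by (simp add: bij_betw_def)
qed

text \<open>Induction along the order of use. After the first box, the same protocol adds the carry
  to the number formed by the higher digits; hence \<open>x\<close> varies in the induction while
  \<open>y\<close> stays fixed.\<close>

lemma record_prob_carry:
  assumes "d \<ge> 2" "x \<in> {0,1}" "y \<in> {0,1}"
    and "\<forall>i\<in>{1..m}. \<alpha> i < d" "\<forall>i\<in>{1..m}. \<beta> i < d"
  shows "record_prob m (\<lambda>i. d_box d) (alice d m x h) (bob d m y h') \<alpha> \<beta> =
    (if digit_value d m \<beta> = (digit_value d m \<alpha> + x * y) mod d ^ m then 1 / real (d ^ m) else 0)"
  using assms(2-)
proof (induction m arbitrary: x h h')
  case 0
  then show ?case by (simp add: record_prob_def)
next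
  case (Suc m)
  define r s where "r = \<alpha> (Suc m)" and "s = \<beta> (Suc m)"
  define u v where "u = digit_value d m \<alpha>" and "v = digit_value d m \<beta>"
  define x' where "x' = carry_input d r x"
  have rs: "r < d" "s < d"
    using Suc.prems by (auto simp: r_def s_def)
  have xy: "x * y < d"
    using Suc.prems(1,2) assms(1) by auto
  have x': "x' \<in> {0,1}"
    using Suc.prems(1) by (auto simp: x'_def carry_input_def)
  \<comment> \<open>Since \<open>r < d\<close>, an overflow requires \<open>x = y = 1\<close> and
    \<open>r = d - 1\<close>, and then the carry is 1.\<close>
  have carry: "(r + x * y) div d = x' * y"
  proof (cases "x = 1 \<and> y = 1 \<and> r = d - 1")
    case True
    then show ?thesis
      using assms(1) by (simp add: x'_def carry_input_def)
  next
    case False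
    then have "r + x * y < d"
      using rs Suc.prems(1,2) by auto
    moreover have "x' * y = 0"
      using False Suc.prems(1,2) by (auto simp: x'_def carry_input_def)
    ultimately show ?thesis
      by simp
  qed
  \<comment> \<open>A residue modulo \<open>d * d ^ m\<close> consists of its lowest digit and the
    residue of the quotient modulo \<open>d ^ m\<close>; the carry enters the quotient.\<close>
  have split: "(r + d * u + x * y) mod (d * d ^ m) =
      (r + x * y) mod d + d * ((u + x' * y) mod d ^ m)"
  proof -
    have "(r + d * u + x * y) div d = u + x' * y"
      using carry rs div_mult_self2[of d "r + x * y" u] by (simp add: algebra_simps)
    moreover have "(r + d * u + x * y) mod d = (r + x * y) mod d"
      using mod_mult_self2[of "r + x * y" d u] by (simp add: algebra_simps)
    ultimately show ?thesis
      by (simp add: mod_mult2_eq)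
  qed
  have "record_prob (Suc m) (\<lambda>i. d_box d) (alice d (Suc m) x h) (bob d (Suc m) y h') \<alpha> \<beta> =
      d_box d r s x y * record_prob m (\<lambda>i. d_box d)
        (alice d m x' (\<lambda>v. h (r + d * v))) (bob d m y (\<lambda>v. h' (s + d * v))) \<alpha> \<beta>"
    by (auto simp: record_prob_def r_def s_def x'_def atLeastAtMostSuc_conv intro!: prod.cong)
  also have "\<dots> = (if s = (r + x * y) mod d then 1 / real d else 0) *
      (if v = (u + x' * y) mod d ^ m then 1 / real (d ^ m) else 0)"
    using Suc.IH[OF x' Suc.prems(2)] Suc.prems(3,4) d_box_eq[OF rs(2) xy]
    by (simp add: u_def v_def)
  also have "\<dots> = (if s + d * v = (r + d * u + x * y) mod (d * d ^ m)
      then 1 / real (d ^ Suc m) else 0)"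
    \<comment> \<open>Uniqueness of lowest digit and quotient merges the two equality tests into
      one.\<close>
    unfolding split using digits_unique[of s d "(r + x * y) mod d"] rs by auto
  finally show ?case
    by (simp add: r_def s_def u_def v_def)
qed

subsection \<open>The simulated box\<close>

text \<open>The joint distribution of \<open>u mod d'\<close> and
  \<open>(u + X * Y) mod D mod d'\<close> for \<open>u\<close> uniform below
  \<open>D\<close>.\<close>

definition reduced_box :: "nat \<Rightarrow> nat \<Rightarrow> box" where
  "reduced_box D d' a b X Y =
     real (card {u \<in> {..<D}. u mod d' = a \<and> (u + X * Y) mod D mod d' = b}) / real D"

lemma output_prob_carry:
  assumes "d \<ge> 2" "X \<in> {0,1}" "Y \<in> {0,1}"
  shows "output_prob n (\<lambda>i. d) (\<lambda>i. d_box d)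
      (alice d n X (\<lambda>v. v mod d')) (bob d n Y (\<lambda>v. v mod d')) a b =
    reduced_box (d ^ n) d' a b X Y"
proof -
  let ?R = "records n (\<lambda>i. d)" and ?D = "d ^ n" and ?f = "digit_value d n"
  let ?S = "alice d n X (\<lambda>v. v mod d')" and ?T = "bob d n Y (\<lambda>v. v mod d')"
  \<comment> \<open>The summand depends on the two records only through their numbers
    \<open>u\<close> and \<open>v\<close>; written as \<open>G u v\<close> it can be
    reindexed.\<close>
  define G where "G u v = (if u mod d' = a \<and> v mod d' = b \<and> v = (u + X * Y) mod ?D
    then 1 / real ?D else 0)" for u v
  have fin: "finite ?R"
    by (simp add: records_def finite_PiE)
  have lt: "\<forall>i\<in>{1..n}. \<alpha> i < d" if "\<alpha> \<in> ?R" for \<alpha>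
    using that by (auto simp: records_def PiE_iff)
  have D: "?D > 0"
    using assms(1) by simp
  have "output_prob n (\<lambda>i. d) (\<lambda>i. d_box d) ?S ?T a b =
      (\<Sum>\<alpha>\<in>?R. if final_output ?S \<alpha> = a then
        (\<Sum>\<beta>\<in>?R. if final_output ?T \<beta> = b
           then record_prob n (\<lambda>i. d_box d) ?S ?T \<alpha> \<beta> else 0) else 0)"
    unfolding output_prob_def using fin by (simp add: sum.inter_filter)
  also have "\<dots> = (\<Sum>\<alpha>\<in>?R. \<Sum>\<beta>\<in>?R. G (?f \<alpha>) (?f \<beta>))"
    using record_prob_carry[OF assms lt lt]
    by (intro sum.cong refl)
      (auto simp: final_output_digit_strategy G_def intro!: sum.cong sum.neutral)
  also have "\<dots> = (\<Sum>u<?D. \<Sum>v<?D. G u v)"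
    using sum.reindex_bij_betw[OF bij_betw_digit_value, of "\<lambda>u. \<Sum>\<beta>\<in>?R. G u (?f \<beta>)"]
      sum.reindex_bij_betw[OF bij_betw_digit_value, of "\<lambda>v. G u v" for u] by simp
  also have "\<dots> = (\<Sum>u<?D. if u mod d' = a \<and> (u + X * Y) mod ?D mod d' = b
      then 1 / real ?D else 0)"
  \<comment> \<open>Given \<open>u\<close>, only the shifted residue contributes as
    \<open>v\<close>, and it lies in the range because \<open>D\<close> is positive.\<close>
  proof (rule sum.cong[OF refl])
    fix u
    have "(\<Sum>v<?D. G u v) = (\<Sum>v<?D. if v = (u + X * Y) mod ?D
        then (if u mod d' = a \<and> v mod d' = b then 1 / real ?D else 0) else 0)"
      by (intro sum.cong) (auto simp: G_def)
    then show "(\<Sum>v<?D. G u v) =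
        (if u mod d' = a \<and> (u + X * Y) mod ?D mod d' = b then 1 / real ?D else 0)"
      using D by (simp add: sum.delta)
  qed
  also have "\<dots> = reduced_box ?D d' a b X Y"
    by (simp add: reduced_box_def flip: sum.inter_filter)
  finally show ?thesis .
qed

lemma simulates_reduced_box:
  assumes "d \<ge> 2" "d' > 0"
  shows "simulates n (\<lambda>i. d) (\<lambda>i. d_box d) d' (reduced_box (d ^ n) d')"
  unfolding simulates_def
proof (intro exI conjI)
  let ?h = "\<lambda>v. v mod d'"
  show "\<forall>s u. \<forall>X\<in>{0,1}. valid_strategy (\<lambda>i. d) d' ((\<lambda>s u X. alice d n X ?h) s u X) {1..n}"
    using assms by (auto intro!: valid_digit_strategy simp del: One_nat_def simp: carry_input_def split: if_splits)
  show "\<forall>s v. \<forall>Y\<in>{0,1}. valid_strategy (\<lambda>i. d) d' ((\<lambda>s v Y. bob d n Y ?h) s v Y) {1..n}"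
    using assms by (auto intro!: valid_digit_strategy simp del: One_nat_def)
  \<comment> \<open>The protocol is deterministic, so point masses serve as shared and local
    randomness.\<close>
  show "\<forall>X\<in>{0,1}. \<forall>Y\<in>{0,1}. \<forall>a<d'. \<forall>b<d'. reduced_box (d ^ n) d' a b X Y =
      measure_pmf.expectation
        (pair_pmf (return_pmf 0) (pair_pmf (return_pmf 0) (return_pmf 0)))
        (\<lambda>(s, u, v). output_prob n (\<lambda>i. d) (\<lambda>i. d_box d)
          ((\<lambda>s u X. alice d n X ?h) s u X) ((\<lambda>s v Y. bob d n Y ?h) s v Y) a b)"
    using output_prob_carry[OF assms(1)] by (simp add: pair_return_pmf1)
qed

section \<open>Marginals of the simulated box and no-signalling\<close>

lemma sum_card_fibres:
  assumes "finite A" "\<And>u. u \<in> A \<Longrightarrow> f u < (k::nat)"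
  shows "(\<Sum>b<k. card {u \<in> A. P u \<and> f u = b}) = card {u \<in> A. P u}"
proof -
  have "{u \<in> A. P u} = (\<Union>b<k. {u \<in> A. P u \<and> f u = b})"
    using assms(2) by auto
  then show ?thesis
    using assms(1) by (simp only:) (subst card_UN_disjoint, auto)
qed

text \<open>Adding \<open>e\<close> modulo \<open>D\<close> is an injective self-map of a finite
  set, hence a permutation of the residues.\<close>

lemma card_shift_mod:
  assumes "D > (0::nat)"
  shows "card {u \<in> {..<D}. P ((u + e) mod D)} = card {u \<in> {..<D}. P u}"
proof -
  have inj: "inj_on (\<lambda>u. (u + e) mod D) {..<D}"
  proof (rule inj_onI)
    fix u v assume uv: "u \<in> {..<D}" "v \<in> {..<D}" and eq: "(u + e) mod D = (v + e) mod D"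
    from eq have "u mod D = v mod D"
      by (simp add: nat_mod_eq_iff)
    with uv show "u = v"
      by simp
  qed
  have surj: "(\<lambda>u. (u + e) mod D) ` {..<D} = {..<D}"
    using assms by (intro endo_inj_surj inj) auto
  have image: "f ` {u \<in> A. P (f u)} = {v \<in> f ` A. P v}" for f :: "nat \<Rightarrow> nat" and A
    by auto
  have "inj_on (\<lambda>u. (u + e) mod D) {u \<in> {..<D}. P ((u + e) mod D)}"
    by (rule inj_on_subset[OF inj]) blast
  from card_image[OF this] show ?thesis
    unfolding image[of "\<lambda>u. (u + e) mod D" "{..<D}"] surj by (rule sym)
qed

lemma sum_reduced_box_Bob:
  assumes "d' > 0"
  shows "(\<Sum>b<d'. reduced_box D d' a b X Y) = real (card {u \<in> {..<D}. u mod d' = a}) / real D"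
  using sum_card_fibres[of "{..<D}" "\<lambda>u. (u + X * Y) mod D mod d'" d' "\<lambda>u. u mod d' = a"] assms
  by (simp add: reduced_box_def flip: sum_divide_distrib of_nat_sum)

text \<open>Summing out Alice's output leaves a condition on Bob's shifted number alone. The shift
  permutes the residues, so neither input affects the count.\<close>

lemma sum_reduced_box_Alice:
  assumes "d' > 0" "D > 0"
  shows "(\<Sum>a<d'. reduced_box D d' a b X Y) = real (card {u \<in> {..<D}. u mod d' = b}) / real D"
  using sum_card_fibres[of "{..<D}" "\<lambda>u. u mod d'" d' "\<lambda>u. (u + X * Y) mod D mod d' = b"]
    card_shift_mod[OF assms(2), of "\<lambda>u. u mod d' = b" "X * Y"] assms
  by (simp add: reduced_box_def conj_commute flip: sum_divide_distrib of_nat_sum)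

lemma nonsignalling_reduced_box:
  assumes "d' > 0" "D > 0"
  shows "nonsignalling_box d' (reduced_box D d')"
proof -
  have "(\<Sum>a<d'. card {u \<in> {..<D}. u mod d' = a}) = D"
    using sum_card_fibres[of "{..<D}" "\<lambda>u. u mod d'" d' "\<lambda>u. True"] assms by simp
  then have "(\<Sum>a<d'. real (card {u \<in> {..<D}. u mod d' = a}) / real D) = 1"
    using assms by (simp flip: sum_divide_distrib of_nat_sum)
  moreover have "0 \<le> reduced_box D d' a b X Y" for a b X Y
    by (simp add: reduced_box_def)
  ultimately show ?thesis
    using assms by (simp add: nonsignalling_box_def sum_reduced_box_Bob sum_reduced_box_Alice)
qed

section \<open>Distance from the ideal box\<close>

lemma card_residue_class:
  assumes "a < d'"
  shows "\<bar>real (card {u \<in> {..<D}. u mod d' = a}) - real D / real d'\<bar> \<le> 1"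
proof -
  \<comment> \<open>\<open>K\<close> is the rational \<open>(D - a) / d'\<close> rounded up, the
    number of \<open>k\<close> with \<open>a + d' * k < D\<close>; \<open>a < d'\<close> keeps the
    subtraction from truncating.\<close>
  define K where "K = (D + (d' - 1 - a)) div d'"
  have less: "a + d' * k < D \<longleftrightarrow> k < K" for k
  proof -
    have "k < K \<longleftrightarrow> Suc k * d' \<le> D + (d' - 1 - a)"
      using assms by (simp add: K_def Suc_le_eq[symmetric] less_eq_div_iff_mult_less_eq del: mult_Suc)
    then show ?thesis
      using assms by (auto simp: mult.commute)
  qed
  have "{u \<in> {..<D}. u mod d' = a} = (\<lambda>k. a + d' * k) ` {..<K}"
  proof (intro equalityI subsetI)
    fix u assume u: "u \<in> {u \<in> {..<D}. u mod d' = a}"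
    then have "u = a + d' * (u div d')"
      by (metis (mono_tags, lifting) mem_Collect_eq mod_mult_div_eq)
    with u less show "u \<in> (\<lambda>k. a + d' * k) ` {..<K}"
      by (metis (mono_tags, lifting) imageI lessThan_iff mem_Collect_eq)
  next
    fix u assume "u \<in> (\<lambda>k. a + d' * k) ` {..<K}"
    then obtain k where "u = a + d' * k" "k < K"
      by blast
    then show "u \<in> {u \<in> {..<D}. u mod d' = a}"
      using less[of k] assms by simp
  qed
  moreover have "inj_on (\<lambda>k. a + d' * k) {..<K}"
    using assms by (auto intro!: inj_onI)
  ultimately have card: "card {u \<in> {..<D}. u mod d' = a} = K"
    by (simp add: card_image)
  have "d' * K \<le> D + d'"
    using times_div_less_eq_dividend[of d' "D + (d' - 1 - a)"] unfolding K_def by linarith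
  \<comment> \<open>The index \<open>K\<close> is the first to fail, so \<open>a + d' * K\<close> is
    at least \<open>D\<close>.\<close>
  moreover have "D \<le> d' * K + d'"
    using less[of K] assms by simp
  ultimately have "real d' * real K \<le> real D + real d'" "real D \<le> real d' * real K + real d'"
    by (metis of_nat_add of_nat_le_iff of_nat_mult)+
  then show ?thesis
    using assms unfolding card by (simp add: abs_le_iff field_simps)
qed

lemma reduced_box_error:
  assumes "d' \<ge> 2" "D > 0" "a < d'" "b < d'" "X \<in> {0,1}" "Y \<in> {0,1}"
  shows "\<bar>reduced_box D d' a b X Y - d_box d' a b X Y\<bar> \<le> 2 / real D"
proof -
  let ?e = "X * Y"
  define W where "W = {u \<in> {..<D}. u mod d' = a \<and> (u + ?e) mod D mod d' = b}"
  define M where "M = {u \<in> {..<D}. u mod d' = a}"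
  have fin: "finite W" "finite M"
    by (simp_all add: W_def M_def)
  have e: "?e \<le> 1"
    using assms(5,6) by auto
  \<comment> \<open>Below \<open>D - 1\<close>, adding a bit stays below \<open>D\<close>, so
    reduction modulo \<open>D\<close> changes nothing.\<close>
  have nowrap: "(u + ?e) mod D mod d' = (a + ?e) mod d'" if "u \<in> M" "u \<noteq> D - 1" for u
  proof -
    have "u + ?e < D"
      using that e by (auto simp: M_def)
    then show ?thesis
      using that by (auto simp: M_def mod_add_left_eq)
  qed
  have box: "d_box d' a b X Y = (if b = (a + ?e) mod d' then 1 / real d' else 0)"
    using assms e by (intro d_box_eq) auto
  have "\<bar>real (card W) - real D * d_box d' a b X Y\<bar> \<le> 2"
  proof (cases "b = (a + ?e) mod d'")
    case True
    \<comment> \<open>At most the wrap-around value is lost from the residue class \<open>M\<close>.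
      This costs 1, and the deviation of \<open>card M\<close> from \<open>D / d'\<close> costs
      another 1.\<close>
    have "M \<subseteq> insert (D - 1) W"
      using nowrap True by (auto simp: W_def M_def)
    then have "card M \<le> Suc (card W)"
      using fin by (metis card_mono card_insert_if finite_insert le_SucI)
    moreover have "card W \<le> card M"
      using fin by (intro card_mono) (auto simp: W_def M_def)
    moreover have "\<bar>real (card M) - real D / real d'\<bar> \<le> 1"
      using card_residue_class[OF assms(3)] by (simp add: M_def)
    moreover have "real D * d_box d' a b X Y = real D / real d'"
      unfolding box using True by simp
    ultimately show ?thesis
      by linarith
  next
    case False
    \<comment> \<open>Outputs forbidden for the ideal box can arise only from the
      wrap-around.\<close>
    have "W \<subseteq> {D - 1}"
      using nowrap False by (auto simp: W_def M_def)
    then have "card W \<le> 1"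
      using card_mono[of "{D - 1}" W] by simp
    then show ?thesis
      unfolding box using False by simp
  qed
  moreover have "reduced_box D d' a b X Y - d_box d' a b X Y =
      (real (card W) - real D * d_box d' a b X Y) / real D"
    using assms(2) by (simp add: reduced_box_def W_def diff_divide_distrib)
  ultimately show ?thesis
    using assms(2) by (simp add: abs_divide divide_right_mono)
qed

theorem mainTheorem8:
  fixes d d' :: nat
  assumes "d \<ge> 2" and "d' \<ge> 2"
  shows "\<exists>(C::real) (c::real). C > 0 \<and> 0 < c \<and> c < 1 \<and>
    (\<forall>n::nat. n \<ge> 1 \<longrightarrow>
      (\<exists>q :: box. nonsignalling_box d' q \<and>
        simulates n (\<lambda>i. d) (\<lambda>i. d_box d) d' q \<and>
        (\<forall>a<d'. \<forall>b<d'. \<forall>X\<in>{0,1}. \<forall>Y\<in>{0,1}.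
          \<bar>q a b X Y - d_box d' a b X Y\<bar> \<le> C * c ^ n)))"
proof (intro exI conjI allI impI)
  \<comment> \<open>The witnesses are \<open>C = 2\<close> and \<open>c = 1 / d\<close>: the error
    bound \<open>2 / D\<close> at \<open>D = d ^ n\<close> is \<open>C * c ^ n\<close>.\<close>
  show "(0::real) < 2" "0 < 1 / real d" "1 / real d < 1"
    using assms by simp_all
  fix n :: nat
  show "nonsignalling_box d' (reduced_box (d ^ n) d')"
    using assms by (intro nonsignalling_reduced_box) auto
  show "simulates n (\<lambda>i. d) (\<lambda>i. d_box d) d' (reduced_box (d ^ n) d')"
    using assms by (intro simulates_reduced_box) auto
  fix a b assume "a < d'" "b < d'"
  then show "\<forall>X\<in>{0,1}. \<forall>Y\<in>{0,1}.
      \<bar>reduced_box (d ^ n) d' a b X Y - d_box d' a b X Y\<bar> \<le> 2 * (1 / real d) ^ n"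
    using reduced_box_error[OF assms(2), of "d ^ n" a b] assms(1)
    by (simp add: power_one_over)
qed

end
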